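(* Let $s,t$ be real numbers with $s\neq0$, $t\neq0$, let $q=\varphi'_{s,t}/\varphi_{s,t}$, and let $d\geq 0$ be an integer. Then \[ \sum_{n=1}^{\infty}\genfrac{\{}{\}}{0pt}{}{n+d-1}{d}_{s,t}x^n=\frac{x}{(\varphi_{s,t}^{d}x;q)_{d+1}}. \]
   Context: The generalized Fibonacci polynomials $\{n\}_{s,t}$ are defined by $\{0\}_{s,t}=0$, $\{1\}_{s,t}=1$, $\{n+2\}_{s,t}=s\{n+1\}_{s,t}+t\{n\}_{s,t}$, and $\{m\}_{s,t}!=\{1\}_{s,t}\cdots\{m\}_{s,t}$. Set $\varphi_{s,t}=\frac{s+\sqrt{s^2+4t}}{2}$, $\varphi'_{s,t}=\frac{s-\sqrt{s^2+4t}}{2}$. For $n\geq1$, $\genfrac{\{}{\}}{0pt}{}{n+d-1}{d}_{s,t}=\frac{\{n\}_{s,t}\{n+1\}_{s,t}\cdots\{n+d-1\}_{s,t}}{\{d\}_{s,t}!}$ (generalized simplicial $d$-polytopic numbers; denominators assumed nonzero). The $q$-Pochhammer symbol is $(a;q)_m=\prod_{k=0}^{m-1}(1-aq^k)$, so $(\varphi_{s,t}^dx;q)_{d+1}=\prod_{k=0}^{d}(1-\varphi_{s,t}^{d-k}\varphi_{s,t}^{\prime\,k}x)$. The identity is between formal power series in $x$. *)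

theory Defs
  imports Complex_Main "HOL-Computational_Algebra.Formal_Power_Series"
begin

fun gfib :: "real \<Rightarrow> real \<Rightarrow> nat \<Rightarrow> real" where
  "gfib s t 0 = 0"
| "gfib s t (Suc 0) = 1"
| "gfib s t (Suc (Suc n)) = s * gfib s t (Suc n) + t * gfib s t n"

definition gfib_fact :: "real \<Rightarrow> real \<Rightarrow> nat \<Rightarrow> real" where
  "gfib_fact s t m = (\<Prod>k=1..m. gfib s t k)"

(* The value {n}{n+1}...{n+d-1} / {d}! is meaningful for n >= 1 and gfib_fact s t d \<noteq> 0. *)
definition gpolytopic :: "real \<Rightarrow> real \<Rightarrow> nat \<Rightarrow> nat \<Rightarrow> real" where
  "gpolytopic s t d n = (\<Prod>k<d. gfib s t (n + k)) / gfib_fact s t d"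

(* Complex-valued because the discriminant s^2 + 4 t may be negative; csqrt is the principal
   root, which on nonnegative reals is the usual real square root. *)
definition phi :: "real \<Rightarrow> real \<Rightarrow> complex" where
  "phi s t = (complex_of_real s + csqrt (complex_of_real (s\<^sup>2 + 4 * t))) / 2"

definition phi' :: "real \<Rightarrow> real \<Rightarrow> complex" where
  "phi' s t = (complex_of_real s - csqrt (complex_of_real (s\<^sup>2 + 4 * t))) / 2"

(* Defined over any commutative ring so that it applies to formal power series. *)
definition q_pochhammer :: "'a::comm_ring_1 \<Rightarrow> 'a \<Rightarrow> nat \<Rightarrow> 'a" where
  "q_pochhammer a q m = (\<Prod>k<m. 1 - a * q ^ k)"

end

(* Write a, b for phi s t, phi' s t and {n} for gfib s t n. Since a, b are the roots of
   z^2 = s z + t, the addition formula {n + m} = b^m {n} + a^n {m} holds, and it needs no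
   distinctness of a and b. With m = d + 1 it says that the generating functions
   G_d(x) = (SUM n. P(d, n + 1) x^n) of the polytopic numbers satisfy
   (1 - b^(d+1) x) G_(d+1)(x) = G_d(a x). The product Q_d(x) of the factors
   1 - a^(d-k) b^k x, k <= d, satisfies Q_(d+1)(x) = (1 - b^(d+1) x) Q_d(a x),
   so G_d Q_d = 1 by induction on d. *)
theory Submission imports Defs begin

lemma phi_plus_phi': "phi s t + phi' s t = of_real s"
  by (simp add: phi_def phi'_def field_simps)

lemma phi_times_phi': "phi s t * phi' s t = - of_real t"
proof -
  have "(csqrt (of_real (s\<^sup>2 + 4 * t)))\<^sup>2 = of_real (s\<^sup>2 + 4 * t)"
    by simp
  then show ?thesis
    unfolding phi_def phi'_def by (simp add: field_simps power2_eq_square)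
qed

lemma phi_nonzero: "t \<noteq> 0 \<Longrightarrow> phi s t \<noteq> 0"
  using phi_times_phi'[of s t] by auto

text \<open>With s = a + b and t = -a b the recurrence reads {n+2} - b {n+1} = a ({n+1} - b {n}), so
  {n+1} - b {n} is geometric with ratio a and initial value 1.\<close>

lemma gfib_Suc_phi:
  "complex_of_real (gfib s t (Suc n)) = phi' s t * of_real (gfib s t n) + phi s t ^ n"
proof (induction n)
  case 0
  then show ?case by simp
next
  case (Suc n)
  have t: "of_real t = - (phi s t * phi' s t)"
    by (simp add: phi_times_phi')
  have "complex_of_real (gfib s t (Suc (Suc n))) =
      (phi s t + phi' s t) * of_real (gfib s t (Suc n)) - phi s t * phi' s t * of_real (gfib s t n)"
    by (simp add: t phi_plus_phi')
  also have "\<dots> = phi' s t * of_real (gfib s t (Suc n))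
      + phi s t * (of_real (gfib s t (Suc n)) - phi' s t * of_real (gfib s t n))"
    by (simp add: algebra_simps)
  also have "of_real (gfib s t (Suc n)) - phi' s t * of_real (gfib s t n) = phi s t ^ n"
    using Suc.IH by simp
  finally show ?case by simp
qed

lemma gfib_add:
  "complex_of_real (gfib s t (n + m)) =
    phi' s t ^ m * of_real (gfib s t n) + phi s t ^ n * of_real (gfib s t m)"
proof (induction m)
  case 0
  then show ?case by simp
next
  case (Suc m)
  then show ?case
    by (simp add: gfib_Suc_phi algebra_simps power_add del: gfib.simps(3))
qed

lemma gfib_fact_Suc: "gfib_fact s t (Suc d) = gfib s t (Suc d) * gfib_fact s t d"
  by (simp add: gfib_fact_def)

text \<open>A Pascal-type rule: over the denominator {d+1}! all three numbers share the product
  {n+1}...{n+d}. The remaining factors {n+d+1}, {n} and {d+1} are related by \<open>gfib_add\<close>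
  with m = d + 1.\<close>

lemma gpolytopic_Suc_Suc:
  assumes "gfib_fact s t (Suc d) \<noteq> 0"
  shows "complex_of_real (gpolytopic s t (Suc d) (Suc n)) =
    phi' s t ^ Suc d * of_real (gpolytopic s t (Suc d) n)
      + phi s t ^ n * of_real (gpolytopic s t d (Suc n))"
proof -
  define A where "A = (\<Prod>k<d. gfib s t (Suc n + k))"
  have nz: "gfib s t (Suc d) \<noteq> 0" "gfib_fact s t d \<noteq> 0"
    using assms by (auto simp: gfib_fact_Suc)
  have 1: "gpolytopic s t (Suc d) (Suc n) = A * gfib s t (n + Suc d) / gfib_fact s t (Suc d)"
    by (simp add: gpolytopic_def A_def)
  have 2: "gpolytopic s t (Suc d) n = gfib s t n * A / gfib_fact s t (Suc d)"
    unfolding gpolytopic_def A_def by (subst prod.lessThan_Suc_shift) simp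
  have 3: "gpolytopic s t d (Suc n) = A * gfib s t (Suc d) / gfib_fact s t (Suc d)"
    using nz by (simp add: gpolytopic_def A_def gfib_fact_Suc)
  show ?thesis
    unfolding 1 2 3 of_real_divide of_real_mult gfib_add[of s t n "Suc d"]
    by (simp add: ring_distribs add_divide_distrib mult_ac del: gfib.simps power_Suc)
qed

text \<open>The index shift removes the factor x of the numerator, so that this series can be the
  inverse of the Pochhammer product.\<close>

definition gpolytopic_fps :: "real \<Rightarrow> real \<Rightarrow> nat \<Rightarrow> complex fps" where
  "gpolytopic_fps s t d = Abs_fps (\<lambda>n. of_real (gpolytopic s t d (Suc n)))"

lemma gpolytopic_fps_Suc:
  assumes "gfib_fact s t (Suc d) \<noteq> 0"
  shows "(1 - fps_const (phi' s t ^ Suc d) * fps_X) * gpolytopic_fps s t (Suc d) =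
    gpolytopic_fps s t d oo (fps_const (phi s t) * fps_X)"
proof (rule fps_ext)
  fix n
  \<comment> \<open>At n = 0 the left side has no term with b^(d+1). The Pascal-type rule still
    fits, since the product here contains {0} = 0.\<close>
  have zero: "gpolytopic s t (Suc d) 0 = 0"
    by (simp add: gpolytopic_def prod.lessThan_Suc_shift del: prod.lessThan_Suc)
  have "fps_nth ((1 - fps_const (phi' s t ^ Suc d) * fps_X) * gpolytopic_fps s t (Suc d)) n =
      of_real (gpolytopic s t (Suc d) (Suc n)) - phi' s t ^ Suc d * of_real (gpolytopic s t (Suc d) n)"
    using zero by (cases n) (simp_all add: gpolytopic_fps_def left_diff_distrib mult.assoc)
  also have "\<dots> = phi s t ^ n * of_real (gpolytopic s t d (Suc n))"
    by (simp add: gpolytopic_Suc_Suc[OF assms] del: power_Suc)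
  finally show "fps_nth ((1 - fps_const (phi' s t ^ Suc d) * fps_X) * gpolytopic_fps s t (Suc d)) n =
      fps_nth (gpolytopic_fps s t d oo (fps_const (phi s t) * fps_X)) n"
    by (simp add: gpolytopic_fps_def fps_compose_linear)
qed

text \<open>Substituting a x for x turns the coefficient a^(d-k) b^k of the k-th factor into
  a^(d+1-k) b^k. This gives the factors k <= d of the larger product; the one for k = d + 1 is split
  off as \<open>top\<close>.\<close>

lemma q_pochhammer_fps_Suc:
  fixes a b :: "'a::field"
  assumes "a \<noteq> 0"
  shows "q_pochhammer (fps_const (a ^ Suc d) * fps_X) (fps_const (b / a)) (Suc (Suc d)) =
    (1 - fps_const (b ^ Suc d) * fps_X) *
      (q_pochhammer (fps_const (a ^ d) * fps_X) (fps_const (b / a)) (Suc d)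
        oo (fps_const a * fps_X))"
proof -
  have top: "fps_const (a ^ Suc d) * fps_X * fps_const (b / a) ^ Suc d = fps_const (b ^ Suc d) * fps_X"
  proof -
    have "fps_const (a ^ Suc d) * fps_X * fps_const (b / a) ^ Suc d =
        fps_const (a ^ Suc d * (b / a) ^ Suc d) * fps_X"
      by (simp add: fps_const_power mult_ac fps_const_mult[symmetric] del: fps_const_mult power_Suc)
    then show ?thesis
      using assms by (simp add: power_divide del: power_Suc)
  qed
  have factor: "(1 - fps_const (a ^ d) * fps_X * fps_const (b / a) ^ k) oo (fps_const a * fps_X) =
      1 - fps_const (a ^ Suc d) * fps_X * fps_const (b / a) ^ k" for k
    by (simp add: fps_compose_sub_distrib fps_compose_mult_distrib fps_const_power
        fps_const_mult[symmetric] mult_ac del: fps_const_mult)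
  have X0: "fps_nth (fps_const a * fps_X) 0 = 0"
    by simp
  show ?thesis
    unfolding q_pochhammer_def prod.lessThan_Suc[of _ "Suc d"] top
    by (subst mult.commute) (simp only: fps_compose_prod_distrib[OF X0] factor)
qed

lemma q_pochhammer_times_gpolytopic_fps:
  assumes "t \<noteq> 0" and "gfib_fact s t d \<noteq> 0"
  shows "q_pochhammer (fps_const (phi s t ^ d) * fps_X) (fps_const (phi' s t / phi s t)) (Suc d)
    * gpolytopic_fps s t d = 1"
  using assms(2)
proof (induction d)
  case 0
  \<comment> \<open>For d = 0 all polytopic numbers are 1, which leaves the geometric
    series.\<close>
  have "(1 - fps_X) * Abs_fps (\<lambda>_. 1) = (1 :: complex fps)"
    by (rule fps_ext) (simp add: left_diff_distrib)
  then show ?case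
    by (simp add: q_pochhammer_def gpolytopic_fps_def gpolytopic_def gfib_fact_def)
next
  case (Suc d)
  let ?q = "fps_const (phi' s t / phi s t)" and ?y = "fps_const (phi s t) * fps_X"
  let ?Q = "q_pochhammer (fps_const (phi s t ^ d) * fps_X) ?q (Suc d)"
  have "q_pochhammer (fps_const (phi s t ^ Suc d) * fps_X) ?q (Suc (Suc d)) * gpolytopic_fps s t (Suc d) =
      (?Q oo ?y) * ((1 - fps_const (phi' s t ^ Suc d) * fps_X) * gpolytopic_fps s t (Suc d))"
    unfolding q_pochhammer_fps_Suc[OF phi_nonzero[OF assms(1)]] by (simp only: mult_ac)
  \<comment> \<open>Composition with \<open>?y\<close> is multiplicative, so the induction
    hypothesis applies inside it.\<close>
  also have "\<dots> = (?Q * gpolytopic_fps s t d) oo ?y"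
    by (simp add: gpolytopic_fps_Suc[OF Suc.prems] fps_compose_mult_distrib del: power_Suc)
  also have "?Q * gpolytopic_fps s t d = 1"
    using Suc by (simp add: gfib_fact_Suc)
  finally show ?case by simp
qed

theorem theorem7:
  fixes s t :: real and q :: complex and d :: nat
  assumes "s \<noteq> 0" and "t \<noteq> 0"
    and "q = phi' s t / phi s t"
    and "gfib_fact s t d \<noteq> 0"
  shows "Abs_fps (\<lambda>n. if n \<ge> 1 then complex_of_real (gpolytopic s t d n) else 0)
    = fps_X / q_pochhammer (fps_const (phi s t ^ d) * fps_X) (fps_const q) (d + 1)"
proof -
  let ?Q = "q_pochhammer (fps_const (phi s t ^ d) * fps_X) (fps_const q) (d + 1)"
  have inv: "?Q * gpolytopic_fps s t d = 1"
    using q_pochhammer_times_gpolytopic_fps[OF assms(2,4)] assms(3) by simp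
  \<comment> \<open>A nonzero constant term of \<open>?Q\<close> turns the division into
    multiplication by the inverse, which \<open>inv\<close> identifies.\<close>
  then have "fps_nth (?Q * gpolytopic_fps s t d) 0 = 1"
    by simp
  then have "fps_nth ?Q 0 \<noteq> 0"
    by auto
  then have "fps_X / ?Q = fps_X * gpolytopic_fps s t d"
    using fps_inverse_unique[OF inv] by (simp add: fps_divide_unit)
  \<comment> \<open>The factor \<open>fps_X\<close> undoes the index shift and gives 0 at n = 0,
    whereas \<open>gpolytopic s t 0 0\<close> is an empty product with value 1.\<close>
  also have "\<dots> = Abs_fps (\<lambda>n. if n \<ge> 1 then complex_of_real (gpolytopic s t d n) else 0)"
    by (rule fps_ext) (auto simp: gpolytopic_fps_def)
  finally show ?thesis by simp
qed

end
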